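(* Let $X$ and $Y$ be Tychonoff spaces and assume that $Y$ is $l$-dominated by $X$. If $X$ is $\sigma$-scattered, then $Y$ is also $\sigma$-scattered; if $X$ is $\sigma$-discrete, then $Y$ is also $\sigma$-discrete.
   Context: For a Tychonoff space $X$, $C_p(X)$ is the space of all real-valued continuous functions on $X$ endowed with the topology of pointwise convergence. A space $Y$ is $l$-dominated by a space $X$ if there exists a continuous linear surjection from $C_p(X)$ onto $C_p(Y)$. A space is scattered if every nonempty subset $A$ of it has a point isolated in $A$. A space $X$ is $\sigma$-scattered ($\sigma$-discrete) if $X=\bigcup_{n\in\omega}X_n$ where every subspace $X_n$ is scattered (respectively, discrete in its subspace topology); the $X_n$ are not required to be closed. *)

theory Defs
  imports "HOL-Analysis.Analysis"
begin

definition tychonoff_space :: "'a topology \<Rightarrow> bool" where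
  "tychonoff_space X \<longleftrightarrow> completely_regular_space X \<and> Hausdorff_space X"

text \<open>
  The points of \<open>C\<^sub>p(X)\<close> are represented as functions that are \<^const>\<open>undefined\<close> outside
  \<open>topspace X\<close>, which is the convention of \<^const>\<open>product_topology\<close>.  The topology of pointwise
  convergence is the one inherited from the product of copies of the real line indexed by the
  points of \<open>X\<close>.
\<close>

definition Cp :: "'a topology \<Rightarrow> ('a \<Rightarrow> real) topology" where
  "Cp X = subtopology (product_topology (\<lambda>x. euclideanreal) (topspace X))
            {f. continuous_map X euclideanreal f}"

lemma topspace_Cp:
  "topspace (Cp X) = {f \<in> extensional (topspace X). continuous_map X euclideanreal f}"
  by (auto simp: Cp_def PiE_def)

text \<open>The vector space operations of \<open>C\<^sub>p(X)\<close> are pointwise on \<open>topspace X\<close>.\<close>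

definition Cp_linear :: "'a topology \<Rightarrow> 'b topology \<Rightarrow> (('a \<Rightarrow> real) \<Rightarrow> ('b \<Rightarrow> real)) \<Rightarrow> bool" where
  "Cp_linear X Y T \<longleftrightarrow>
     (\<forall>f \<in> topspace (Cp X). \<forall>g \<in> topspace (Cp X).
        T (\<lambda>x\<in>topspace X. f x + g x) = (\<lambda>y\<in>topspace Y. T f y + T g y)) \<and>
     (\<forall>c. \<forall>f \<in> topspace (Cp X).
        T (\<lambda>x\<in>topspace X. c * f x) = (\<lambda>y\<in>topspace Y. c * T f y))"

definition l_dominated_by :: "'b topology \<Rightarrow> 'a topology \<Rightarrow> bool" where
  "l_dominated_by Y X \<longleftrightarrow>
     (\<exists>T. continuous_map (Cp X) (Cp Y) T \<and> Cp_linear X Y T \<and>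
          T ` topspace (Cp X) = topspace (Cp Y))"

definition scattered_space :: "'a topology \<Rightarrow> bool" where
  "scattered_space X \<longleftrightarrow>
     (\<forall>A. A \<subseteq> topspace X \<and> A \<noteq> {} \<longrightarrow> (\<exists>x\<in>A. openin (subtopology X A) {x}))"

definition sigma_scattered :: "'a topology \<Rightarrow> bool" where
  "sigma_scattered X \<longleftrightarrow>
     (\<exists>F :: nat \<Rightarrow> 'a set. topspace X = (\<Union>n. F n) \<and>
        (\<forall>n. scattered_space (subtopology X (F n))))"

definition sigma_discrete :: "'a topology \<Rightarrow> bool" where
  "sigma_discrete X \<longleftrightarrow>
     (\<exists>F :: nat \<Rightarrow> 'a set. topspace X = (\<Union>n. F n) \<and>
        (\<forall>n. subtopology X (F n) = discrete_topology (F n)))"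

end

theory Submission
  imports Defs
begin

text \<open>
  A continuous linear surjection \<open>T\<close> from \<open>C\<^sub>p(X)\<close> onto \<open>C\<^sub>p(Y)\<close> turns every point \<open>y\<close> of \<open>Y\<close> into
  a continuous functional \<open>f \<mapsto> T f y\<close>, and such a functional is a linear combination of finitely
  many point evaluations with nonzero coefficients.  Let \<open>S y\<close> be the finite set of points of \<open>X\<close>
  that occur.  Three properties of \<open>S\<close> are all that the theorem needs.  The sets \<open>S y\<close> are finite;
  \<open>S\<close> is lower semicontinuous, because a function concentrated near \<open>x \<in> S y\<close> is mapped to a
  function that does not vanish near \<open>y\<close>; and only finitely many \<open>y\<close> share the same set \<open>S y\<close>,
  because surjectivity makes the functionals of distinct points linearly independent.

  The rest is topology.  Write \<open>X = \<Union>i. F i\<close> and decompose \<open>Y\<close> into the countably many pieces of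
  those \<open>y\<close> with \<open>card (S y) = n\<close> and \<open>S y \<subseteq> (\<Union>i<m. F i)\<close>.  Fixing the cardinality makes lower
  semicontinuity into continuity: if \<open>U x\<close>, for \<open>x \<in> S y\<close>, are disjoint neighbourhoods, then for all
  \<open>z\<close> of the piece near \<open>y\<close> the set \<open>S z\<close> has exactly one point in every \<open>U x\<close>.  Near \<open>y\<close> the piece
  is therefore mapped, continuously and with finite fibres, into a finite power of
  \<open>\<Union>i<m. F i\<close>.

  If the \<open>F i\<close> are scattered, so is their finite union, and isolating the coordinates one after the
  other shows that the piece is scattered (\<open>scattered_piece\<close>).  If the \<open>F i\<close> are discrete, then near
  \<open>y\<close> the piece is a union of finitely many discrete sets, one for each way of assigning an index
  \<open>i < m\<close> to each coordinate.  A set that is locally a finite union of discrete sets loses every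
  point after finitely many Cantor-Bendixson derivatives (\<open>cb_derivative_card_cover\<close>), and the
  successive differences of these derivatives are discrete.  Local information is enough here
  because the derivatives, unlike a decomposition into discrete sets, are determined locally.
\<close>

section \<open>Scattered sets and finite Cantor-Bendixson rank\<close>

lemma not_in_derived_set_nhd:
  assumes "x \<in> topspace X" "x \<notin> X derived_set_of B"
  obtains T where "openin X T" "x \<in> T" "T \<inter> B \<subseteq> {x}"
proof -
  have "\<exists>T. openin X T \<and> x \<in> T \<and> T \<inter> B \<subseteq> {x}"
    using assms by (auto simp: in_derived_set_of)
  then show thesis using that by blast
qed

lemma isolated_point_nhd:
  assumes "x \<in> B" "B \<subseteq> topspace X" "x \<notin> X derived_set_of B"
  obtains T where "openin X T" "T \<inter> B = {x}"
proof -
  have "x \<in> topspace X" using assms(1,2) by blast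
  then obtain T where "openin X T" "x \<in> T" "T \<inter> B \<subseteq> {x}"
    using assms(3) by (rule not_in_derived_set_nhd)
  then show thesis using assms(1) by (intro that[of T]) auto
qed

lemma scattered_space_subtopology_iff:
  "scattered_space (subtopology X P) \<longleftrightarrow>
     (\<forall>B \<subseteq> topspace X \<inter> P. B \<noteq> {} \<longrightarrow> \<not> B \<subseteq> X derived_set_of B)"
proof -
  have "(\<exists>x\<in>B. openin (subtopology (subtopology X P) B) {x}) \<longleftrightarrow> \<not> B \<subseteq> X derived_set_of B"
    if B: "B \<subseteq> topspace X \<inter> P" for B
  proof -
    have eq: "subtopology (subtopology X P) B = subtopology X B"
      using B by (simp add: subtopology_subtopology inf.absorb2)
    have "openin (subtopology X B) {x} \<longleftrightarrow> x \<notin> X derived_set_of B" if "x \<in> B" for x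
    proof
      assume "openin (subtopology X B) {x}"
      then obtain T where "openin X T" "{x} = T \<inter> B"
        by (auto simp: openin_subtopology)
      then show "x \<notin> X derived_set_of B"
        by (auto simp: in_derived_set_of)
    next
      assume "x \<notin> X derived_set_of B"
      moreover have "B \<subseteq> topspace X" using B by blast
      ultimately have "\<exists>T. openin X T \<and> T \<inter> B = {x}"
        using isolated_point_nhd[OF that] by metis
      then show "openin (subtopology X B) {x}"
        by (auto simp: openin_subtopology)
    qed
    then show ?thesis using eq by auto
  qed
  moreover have "topspace (subtopology X P) = topspace X \<inter> P" by simp
  ultimately show ?thesis
    unfolding scattered_space_def by metis
qed

text \<open>
  If a point that is isolated in \<open>B \<inter> P\<close> is not isolated in \<open>B\<close>, its neighbourhood contains other
  points of \<open>B\<close>, all of them in \<open>Q\<close>, and one that is isolated among these is isolated in \<open>B\<close>.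
\<close>
lemma scattered_Un:
  assumes t1: "t1_space X"
    and P: "scattered_space (subtopology X P)" and Q: "scattered_space (subtopology X Q)"
  shows "scattered_space (subtopology X (P \<union> Q))"
  unfolding scattered_space_subtopology_iff
proof (intro allI impI notI)
  fix B assume B: "B \<subseteq> topspace X \<inter> (P \<union> Q)" "B \<noteq> {}" and dense: "B \<subseteq> X derived_set_of B"
  show False
  proof (cases "B \<inter> P = {}")
    case True
    with B Q dense show False unfolding scattered_space_subtopology_iff by blast
  next
    case False
    moreover have "B \<inter> P \<subseteq> topspace X \<inter> P" using B by blast
    ultimately have "\<not> B \<inter> P \<subseteq> X derived_set_of (B \<inter> P)"
      using P unfolding scattered_space_subtopology_iff by metis
    then obtain p where p: "p \<in> B \<inter> P" "p \<notin> X derived_set_of (B \<inter> P)" by blast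
    then obtain V where V: "openin X V" "V \<inter> (B \<inter> P) = {p}"
      using isolated_point_nhd[of p "B \<inter> P" X] B by blast
    define C where "C = V \<inter> B - {p}"
    have "p \<in> X derived_set_of B" "p \<in> V" using dense p V by auto
    then obtain z where "z \<noteq> p" "z \<in> B" "z \<in> V"
      using V(1) unfolding in_derived_set_of by meson
    then have "C \<noteq> {}" by (auto simp: C_def)
    moreover have "C \<subseteq> topspace X \<inter> Q" using V B by (auto simp: C_def)
    ultimately obtain q where q: "q \<in> C" "q \<notin> X derived_set_of C"
      using Q unfolding scattered_space_subtopology_iff by blast
    then obtain W where W: "openin X W" "W \<inter> C = {q}"
      using isolated_point_nhd[of q C X] \<open>C \<subseteq> topspace X \<inter> Q\<close> by blast
    have "openin X (W \<inter> (V - {p}))"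
      using V W t1 p by (metis openin_Int t1_space_openin_delete IntE insertI1)
    moreover have "q \<in> W \<inter> (V - {p})" "q \<in> B" using q W by (auto simp: C_def)
    moreover from this have "q \<in> X derived_set_of B" using dense by blast
    ultimately obtain z where "z \<noteq> q" "z \<in> B" "z \<in> W \<inter> (V - {p})"
      unfolding in_derived_set_of by meson
    then show False using W by (auto simp: C_def)
  qed
qed

lemma scattered_UN_lessThan:
  assumes "t1_space X" "\<And>i. scattered_space (subtopology X (F i))"
  shows "scattered_space (subtopology X (\<Union>i<m::nat. F i))"
proof (induction m)
  case 0
  then show ?case by (simp add: scattered_space_def)
next
  case (Suc m)
  then show ?case
    using scattered_Un[OF assms(1) assms(2) Suc] by (simp add: lessThan_Suc)
qed

primrec cb_derivative :: "'a topology \<Rightarrow> 'a set \<Rightarrow> nat \<Rightarrow> 'a set" where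
  "cb_derivative X A 0 = A"
| "cb_derivative X A (Suc n) = cb_derivative X A n \<inter> X derived_set_of (cb_derivative X A n)"

lemma cb_derivative_subset: "cb_derivative X A n \<subseteq> A"
  by (induction n) auto

text \<open>
  Removing the derivative leaves only isolated points, and these stay isolated among themselves.
\<close>
lemma cb_level_discrete:
  assumes "A \<subseteq> topspace X"
  defines "D \<equiv> (\<lambda>n. cb_derivative X A n - cb_derivative X A (Suc n))"
  shows "subtopology X (D n) = discrete_topology (D n)"
proof -
  have "D n \<inter> X derived_set_of (D n) \<subseteq> D n \<inter> X derived_set_of (cb_derivative X A n)"
    using derived_set_of_mono[of "D n" "cb_derivative X A n" X] by (auto simp: D_def)
  then have "D n \<inter> X derived_set_of (D n) = {}" by (auto simp: D_def)
  moreover have "D n \<subseteq> topspace X"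
    using assms cb_derivative_subset[of X A n] by (auto simp: D_def)
  ultimately show ?thesis by (simp add: subtopology_eq_discrete_topology_eq)
qed

text \<open>
  Each discrete set in a local cover costs one derivative: a point \<open>x\<close> of \<open>D\<close> that survives has
  surviving points arbitrarily near to it, and close to \<open>x\<close> these are covered by the remaining sets.
  Stating the cover on an open set \<open>V\<close> only, while \<open>A\<close> stays fixed, allows the induction to shrink
  \<open>V\<close> and gives the result in local form.
\<close>
lemma cb_derivative_card_cover:
  assumes t1: "t1_space X" and "finite \<D>"
    and "\<And>D. D \<in> \<D> \<Longrightarrow> D \<inter> X derived_set_of D = {}"
    and "openin X V" and "A \<inter> V \<subseteq> \<Union>\<D>"
  shows "cb_derivative X A (card \<D>) \<inter> V = {}"
  using assms(2-)
proof (induction "card \<D>" arbitrary: \<D> V)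
  case 0
  then show ?case by auto
next
  case (Suc n)
  show ?case
  proof (rule ccontr)
    assume "cb_derivative X A (card \<D>) \<inter> V \<noteq> {}"
    then obtain x where x: "x \<in> cb_derivative X A n" "x \<in> X derived_set_of (cb_derivative X A n)"
        "x \<in> V"
      by (auto simp: Suc.hyps(2)[symmetric])
    then obtain D where D: "D \<in> \<D>" "x \<in> D"
      using Suc.prems(4) cb_derivative_subset[of X A n] by blast
    have "x \<in> topspace X" using x by (simp add: in_derived_set_of)
    moreover have "x \<notin> X derived_set_of D" using D Suc.prems(2)[OF D(1)] by blast
    ultimately obtain T where T: "openin X T" "x \<in> T" "T \<inter> D \<subseteq> {x}"
      by (rule not_in_derived_set_nhd)
    \<comment> \<open>Deleting the point \<open>x\<close> removes all of \<open>D\<close> from the neighbourhood.\<close>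
    define W where "W = V \<inter> T - {x}"
    have "openin X (V \<inter> T)" "x \<in> V \<inter> T" using T Suc.prems(3) x by auto
    then obtain z where z: "z \<noteq> x" "z \<in> cb_derivative X A n" "z \<in> V \<inter> T"
      using x(2) unfolding in_derived_set_of by meson
    have "openin X W"
      using \<open>openin X (V \<inter> T)\<close> \<open>x \<in> V \<inter> T\<close> t1 by (simp add: W_def t1_space_openin_delete)
    moreover have "A \<inter> W \<subseteq> \<Union>(\<D> - {D})"
      using Suc.prems(4) T(3) by (auto simp: W_def)
    moreover have "n = card (\<D> - {D})" using Suc.hyps(2) D Suc.prems(1) by simp
    ultimately have "cb_derivative X A n \<inter> W = {}"
      using Suc.hyps(1)[of "\<D> - {D}" W] Suc.prems by auto
    then show False using z by (auto simp: W_def)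
  qed
qed

lemma sigma_discrete_countable_cover:
  fixes D :: "'i::countable \<Rightarrow> 'a set"
  assumes "topspace X = (\<Union>i. D i)"
    and "\<And>i. subtopology X (D i) = discrete_topology (D i)"
  shows "sigma_discrete X"
  unfolding sigma_discrete_def
proof (intro exI conjI allI)
  show "topspace X = (\<Union>n. D (from_nat n))"
    using assms(1) by auto (metis from_nat_to_nat)
qed (rule assms(2))

lemma sigma_scattered_countable_cover:
  fixes D :: "'i::countable \<Rightarrow> 'a set"
  assumes "topspace X = (\<Union>i. D i)"
    and "\<And>i. scattered_space (subtopology X (D i))"
  shows "sigma_scattered X"
  unfolding sigma_scattered_def
proof (intro exI conjI allI)
  show "topspace X = (\<Union>n. D (from_nat n))"
    using assms(1) by auto (metis from_nat_to_nat)
qed (rule assms(2))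

section \<open>Lower semicontinuous finite-valued maps with finite fibres\<close>

lemma Hausdorff_finite_disjoint_nhds:
  assumes "Hausdorff_space X" "finite I" "I \<subseteq> topspace X"
  obtains U where "\<And>x. x \<in> I \<Longrightarrow> openin X (U x) \<and> x \<in> U x" "disjoint_family_on U I"
proof -
  have "\<forall>x z. \<exists>G H. x \<in> topspace X \<and> z \<in> topspace X \<and> x \<noteq> z \<longrightarrow>
     openin X G \<and> openin X H \<and> x \<in> G \<and> z \<in> H \<and> disjnt G H"
    using assms(1) unfolding Hausdorff_space_def by blast
  then obtain G H where GH: "\<And>x z. x \<in> topspace X \<Longrightarrow> z \<in> topspace X \<Longrightarrow> x \<noteq> z \<Longrightarrow>
     openin X (G x z) \<and> openin X (H x z) \<and> x \<in> G x z \<and> z \<in> H x z \<and> disjnt (G x z) (H x z)"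
    by metis
  define U where "U x = (\<Inter>z\<in>I-{x}. G x z \<inter> H z x) \<inter> topspace X" for x
  show thesis
  proof
    fix x assume x: "x \<in> I"
    have "openin X (U x)"
      unfolding U_def using assms x GH by (intro openin_INT) (auto intro!: openin_Int)
    moreover have "x \<in> U x" unfolding U_def using assms x GH by auto
    ultimately show "openin X (U x) \<and> x \<in> U x" ..
  next
    have "U x \<inter> U z = {}" if "x \<in> I" "z \<in> I" "x \<noteq> z" for x z
    proof -
      have "U x \<subseteq> G x z" "U z \<subseteq> H x z"
        using that by (auto simp: U_def)
      then show ?thesis using GH[of x z] that assms(3) by (auto simp: disjnt_def)
    qed
    then show "disjoint_family_on U I" by (auto simp: disjoint_family_on_def)
  qed
qed

text \<open>
  The cardinality leaves no room for more than one point in each of the disjoint sets.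
\<close>
lemma transversal_eq_image:
  assumes "finite S" "card S = card I" "disjoint_family_on U I"
    and "\<And>x. x \<in> I \<Longrightarrow> p x \<in> S \<inter> U x"
  shows "S = p ` I"
proof -
  have "inj_on p I"
    using assms(3,4) unfolding inj_on_def disjoint_family_on_def by (metis IntD2 IntI empty_iff)
  then have "card (p ` I) = card S" using assms(2) by (simp add: card_image)
  moreover have "p ` I \<subseteq> S" using assms(4) by auto
  ultimately show ?thesis using assms(1) card_subset_eq by metis
qed

lemma not_derived_if_finite_nhd:
  assumes "t1_space X" "openin X W" "finite (W \<inter> B)" "x \<in> W"
  shows "x \<notin> X derived_set_of B"
proof
  assume d: "x \<in> X derived_set_of B"
  have "W \<subseteq> topspace X" using assms(2) openin_subset by blast
  then have "closedin X (W \<inter> B - {x})"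
    using assms(1,3) by (auto simp: t1_space_closedin_finite)
  then have "openin X (W - (W \<inter> B - {x}))" using assms(2) by (rule openin_diff[rotated])
  moreover have "x \<in> W - (W \<inter> B - {x})" using assms(4) by blast
  ultimately obtain y where "y \<noteq> x" "y \<in> B" "y \<in> W - (W \<inter> B - {x})"
    using d unfolding in_derived_set_of by meson
  then show False by blast
qed

text \<open>
  The properties of the support map \<open>y \<mapsto> S y\<close> of a linear surjection from which the topological
  part of the argument proceeds, isolated from any function space.
\<close>
locale finite_lsc_map =
  fixes X :: "'a topology" and Y :: "'b topology" and S :: "'b \<Rightarrow> 'a set"
  assumes Hausdorff: "Hausdorff_space X" and t1: "t1_space Y"
    and finite_S: "y \<in> topspace Y \<Longrightarrow> finite (S y)"
    and S_subset: "y \<in> topspace Y \<Longrightarrow> S y \<subseteq> topspace X"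
    and lsc: "openin X U \<Longrightarrow> openin Y {y \<in> topspace Y. S y \<inter> U \<noteq> {}}"
    and finite_fibre: "finite {y \<in> topspace Y. S y = G}"
begin

definition piece :: "'a set \<Rightarrow> nat \<Rightarrow> 'b set" where
  "piece P n = {y \<in> topspace Y. card (S y) = n \<and> S y \<subseteq> P}"

definition meeting :: "'a set \<Rightarrow> ('a \<Rightarrow> 'a set) \<Rightarrow> 'b set" where
  "meeting I U = {y \<in> topspace Y. \<forall>x\<in>I. S y \<inter> U x \<noteq> {}}"

lemma openin_meeting:
  assumes "finite I" "\<And>x. x \<in> I \<Longrightarrow> openin X (U x)"
  shows "openin Y (meeting I U)"
proof -
  have "meeting I U = (\<Inter>x\<in>I. {y \<in> topspace Y. S y \<inter> U x \<noteq> {}}) \<inter> topspace Y"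
    by (auto simp: meeting_def)
  then show ?thesis using assms lsc by (simp add: openin_INT)
qed

lemma disjoint_nhds:
  assumes "y \<in> topspace Y"
  obtains U where "\<And>x. x \<in> S y \<Longrightarrow> openin X (U x) \<and> x \<in> U x" "disjoint_family_on U (S y)"
    "openin Y (meeting (S y) U)" "y \<in> meeting (S y) U"
proof -
  obtain U where U: "\<And>x. x \<in> S y \<Longrightarrow> openin X (U x) \<and> x \<in> U x" "disjoint_family_on U (S y)"
    using Hausdorff_finite_disjoint_nhds[OF Hausdorff finite_S[OF assms] S_subset[OF assms]]
    by blast
  moreover have "openin Y (meeting (S y) U)" using U finite_S[OF assms] openin_meeting by blast
  moreover have "y \<in> meeting (S y) U" using U assms by (auto simp: meeting_def)
  ultimately show thesis using that by blast
qed

text \<open>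
  Starting from disjoint neighbourhoods of the points of \<open>S y0\<close>, the coordinates are frozen one after
  the other: the values of a coordinate on the current open subset of \<open>B\<close> lie in \<open>P\<close>, hence have an
  isolated value, and lower semicontinuity allows passing to a smaller open set on which the
  coordinate takes only that value.  When all coordinates are frozen, finitely many points are left.
\<close>
lemma scattered_piece:
  assumes P: "scattered_space (subtopology X P)"
  shows "scattered_space (subtopology Y (piece P n))"
  unfolding scattered_space_subtopology_iff
proof (intro allI impI)
  fix B assume B: "B \<subseteq> topspace Y \<inter> piece P n" and "B \<noteq> {}"
  then obtain y0 where y0: "y0 \<in> B" by blast
  then have y0Y: "y0 \<in> topspace Y" using B by auto
  obtain U where U: "\<And>x. x \<in> S y0 \<Longrightarrow> openin X (U x) \<and> x \<in> U x"
    and disj: "disjoint_family_on U (S y0)"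
    and N: "openin Y (meeting (S y0) U)" "y0 \<in> meeting (S y0) U"
    using disjoint_nhds[OF y0Y] by blast
  \<comment> \<open>\<open>J\<close> is the set of coordinates on which \<open>S\<close> is constant over the open part \<open>W \<inter> B\<close>.\<close>
  have freeze: "\<exists>W. openin Y W \<and> W \<inter> B \<noteq> {} \<and> W \<subseteq> meeting (S y0) U \<and>
          (\<forall>x\<in>J. \<exists>p. \<forall>y\<in>W \<inter> B. p \<in> S y \<inter> U x)" if "finite J" "J \<subseteq> S y0" for J
    using that
  proof (induction J rule: finite_induct)
    case empty
    then show ?case using N y0 by auto
  next
    case (insert x J)
    then obtain W where W: "openin Y W" "W \<inter> B \<noteq> {}" "W \<subseteq> meeting (S y0) U"
      "\<forall>x\<in>J. \<exists>p. \<forall>y\<in>W \<inter> B. p \<in> S y \<inter> U x" by auto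
    have x: "x \<in> S y0" using insert by auto
    define Q where "Q = (\<Union>y\<in>W \<inter> B. S y \<inter> U x)"
    obtain y1 where "y1 \<in> W \<inter> B" using W(2) by blast
    moreover from this have "S y1 \<inter> U x \<noteq> {}" using W(3) x by (auto simp: meeting_def)
    ultimately have "Q \<noteq> {}" by (auto simp: Q_def)
    moreover have Q: "Q \<subseteq> topspace X \<inter> P"
      using B S_subset by (fastforce simp: Q_def piece_def)
    ultimately obtain p where p: "p \<in> Q" "p \<notin> X derived_set_of Q"
      using P unfolding scattered_space_subtopology_iff by blast
    then obtain G where G: "openin X G" "G \<inter> Q = {p}"
      using isolated_point_nhd[of p Q X] Q by blast
    define W' where "W' = W \<inter> {y \<in> topspace Y. S y \<inter> (G \<inter> U x) \<noteq> {}}"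
    have "openin Y W'"
      unfolding W'_def using W G U[OF x] by (intro openin_Int lsc) auto
    moreover have "W' \<inter> B \<noteq> {}"
      using p G(2) B by (fastforce simp: Q_def W'_def)
    moreover
    have px: "p \<in> S y \<inter> U x" if "y \<in> W' \<inter> B" for y
    proof -
      obtain q where "q \<in> S y \<inter> (G \<inter> U x)" using \<open>y \<in> W' \<inter> B\<close> by (auto simp: W'_def)
      moreover from this have "q \<in> G \<inter> Q" using \<open>y \<in> W' \<inter> B\<close> by (auto simp: Q_def W'_def)
      ultimately show ?thesis using G(2) by auto
    qed
    moreover have "\<exists>p. \<forall>y\<in>W' \<inter> B. p \<in> S y \<inter> U t" if t: "t \<in> insert x J" for t
    proof (cases "t = x")
      case True
      then show ?thesis using px by blast
    next
      case False
      then obtain r where "\<forall>y\<in>W \<inter> B. r \<in> S y \<inter> U t" using W(4) t by blast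
      then show ?thesis by (auto simp: W'_def)
    qed
    moreover have "W' \<subseteq> meeting (S y0) U" using W(3) by (auto simp: W'_def)
    ultimately show ?case by blast
  qed
  obtain W where W: "openin Y W" "W \<inter> B \<noteq> {}"
    "\<forall>x\<in>S y0. \<exists>p. \<forall>y\<in>W \<inter> B. p \<in> S y \<inter> U x"
    using freeze[OF finite_S[OF y0Y] subset_refl] by (elim exE conjE)
  obtain p where p: "\<forall>x\<in>S y0. \<forall>y\<in>W \<inter> B. p x \<in> S y \<inter> U x"
    using bchoice[OF W(3)] by (elim exE)
  have card_eq: "card (S y) = n" if "y \<in> B" for y using that B by (auto simp: piece_def)
  have "S y = p ` S y0" if "y \<in> W \<inter> B" for y
    using that B y0 p finite_S disj card_eq
    by (intro transversal_eq_image[of _ _ U]) auto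
  then have "W \<inter> B \<subseteq> {y \<in> topspace Y. S y = p ` S y0}" using B by auto
  then have "finite (W \<inter> B)" using finite_fibre finite_subset by blast
  then have "z \<notin> Y derived_set_of B" if "z \<in> W" for z
    using not_derived_if_finite_nhd[OF t1 W(1)] that by blast
  then show "\<not> B \<subseteq> Y derived_set_of B" using W(2) by auto
qed

text \<open>
  When each coordinate runs through a discrete set \<open>E x\<close>, nearby points of \<open>D\<close> have the same
  coordinates, so there are only finitely many of them.
\<close>
lemma discrete_selection:
  assumes y: "y \<in> topspace Y" and U: "\<And>x. x \<in> S y \<Longrightarrow> openin X (U x)"
    and disj: "disjoint_family_on U (S y)"
    and E: "\<And>x. x \<in> S y \<Longrightarrow> E x \<inter> X derived_set_of (E x) = {}"
  defines "D \<equiv> {z \<in> meeting (S y) U. card (S z) = card (S y) \<and> (\<forall>x\<in>S y. S z \<inter> U x \<subseteq> E x)}"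
  shows "D \<inter> Y derived_set_of D = {}"
proof -
  have "z \<notin> Y derived_set_of D" if z: "z \<in> D" for z
  proof -
    have zY: "z \<in> topspace Y" using z by (auto simp: D_def meeting_def)
    have "\<exists>p V. p \<in> S z \<inter> U x \<and> openin X V \<and> p \<in> V \<and> V \<inter> E x \<subseteq> {p}" if x: "x \<in> S y" for x
    proof -
      have "S z \<inter> U x \<noteq> {}" using z x by (auto simp: D_def meeting_def)
      then obtain p where p: "p \<in> S z \<inter> U x" by blast
      then have "p \<in> E x" "p \<in> topspace X" using z x S_subset[OF zY] by (auto simp: D_def)
      then have "\<exists>V. openin X V \<and> p \<in> V \<and> V \<inter> E x \<subseteq> {p}"
        using E[OF x] by (metis IntI empty_iff not_in_derived_set_nhd)
      then show ?thesis using p by blast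
    qed
    then obtain p V where pV: "\<And>x. x \<in> S y \<Longrightarrow> p x \<in> S z \<inter> U x \<and> openin X (V x) \<and> p x \<in> V x \<and>
        V x \<inter> E x \<subseteq> {p x}" by metis
    define W where "W = meeting (S y) (\<lambda>x. U x \<inter> V x)"
    have W: "openin Y W"
      unfolding W_def using finite_S[OF y] U pV by (intro openin_meeting) auto
    have "z \<in> W" using pV zY by (auto simp: W_def meeting_def)
    have "S w = p ` S y" if w: "w \<in> W \<inter> D" for w
    proof (rule transversal_eq_image[OF _ _ disj])
      show "finite (S w)" "card (S w) = card (S y)"
        using w finite_S by (auto simp: D_def meeting_def)
      fix x assume x: "x \<in> S y"
      then obtain q where q: "q \<in> S w" "q \<in> U x" "q \<in> V x"
        using w by (auto simp: W_def meeting_def)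
      then have "q \<in> E x" using w x by (auto simp: D_def)
      then show "p x \<in> S w \<inter> U x" using q pV[OF x] by auto
    qed
    then have "W \<inter> D \<subseteq> {w \<in> topspace Y. S w = p ` S y}" by (auto simp: D_def meeting_def)
    then have "finite (W \<inter> D)" using finite_fibre finite_subset by blast
    then show ?thesis using not_derived_if_finite_nhd[OF t1 W] \<open>z \<in> W\<close> by blast
  qed
  then show ?thesis by blast
qed

text \<open>
  An unordered set of points cannot be given a single type \<open>k\<close> consistently over the whole piece,
  as limits may interchange types.  Near \<open>y\<close> the disjoint neighbourhoods label the coordinates, so
  types make sense there, and the pieces of the different types form a finite cover by discrete sets.
\<close>
lemma piece_finite_cb_rank:
  fixes F :: "nat \<Rightarrow> 'a set"
  assumes F: "\<And>i. F i \<inter> X derived_set_of (F i) = {}"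
    and y: "y \<in> piece (\<Union>i<m. F i) n"
  shows "\<exists>k. y \<notin> cb_derivative Y (piece (\<Union>i<m. F i) n) k"
proof -
  have yY: "y \<in> topspace Y" and cardy: "card (S y) = n" using y by (auto simp: piece_def)
  obtain U where U: "\<And>x. x \<in> S y \<Longrightarrow> openin X (U x) \<and> x \<in> U x"
    and disj: "disjoint_family_on U (S y)"
    and N: "openin Y (meeting (S y) U)" "y \<in> meeting (S y) U"
    using disjoint_nhds[OF yY] by blast
  define D where "D k = {z \<in> meeting (S y) U. card (S z) = card (S y) \<and>
      (\<forall>x\<in>S y. S z \<inter> U x \<subseteq> F (k x))}" for k
  define \<D> where "\<D> = D ` (S y \<rightarrow>\<^sub>E {..<m})"
  have fin: "finite \<D>" using finite_S[OF yY] by (simp add: \<D>_def finite_PiE)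
  have disc: "d \<inter> Y derived_set_of d = {}" if "d \<in> \<D>" for d
  proof -
    obtain k where "d = D k" using \<open>d \<in> \<D>\<close> by (auto simp: \<D>_def)
    then show ?thesis
      using discrete_selection[OF yY _ disj, of "\<lambda>x. F (k x)"] U F by (simp add: D_def)
  qed
  have cover: "piece (\<Union>i<m. F i) n \<inter> meeting (S y) U \<subseteq> \<Union>\<D>"
  proof
    fix z assume z: "z \<in> piece (\<Union>i<m. F i) n \<inter> meeting (S y) U"
    have zY: "z \<in> topspace Y" using z by (auto simp: piece_def)
    have "\<forall>x\<in>S y. \<exists>p. p \<in> S z \<inter> U x" using z by (auto simp: meeting_def)
    then obtain p where p: "\<And>x. x \<in> S y \<Longrightarrow> p x \<in> S z \<inter> U x" by metis
    have Sz: "S z = p ` S y"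
      using z p cardy finite_S[OF zY] disj
      by (intro transversal_eq_image[of _ _ U]) (auto simp: piece_def)
    have "\<forall>x\<in>S y. \<exists>i<m. p x \<in> F i" using z p by (force simp: piece_def)
    then obtain k where k: "\<And>x. x \<in> S y \<Longrightarrow> k x < m \<and> p x \<in> F (k x)" by metis
    have "S z \<inter> U x \<subseteq> F (k x)" if x: "x \<in> S y" for x
    proof
      fix q assume q: "q \<in> S z \<inter> U x"
      then obtain x' where x': "x' \<in> S y" "q = p x'" using Sz by auto
      then have "x' = x" using p[OF x'(1)] q x disj by (auto simp: disjoint_family_on_def)
      then show "q \<in> F (k x)" using x' k by auto
    qed
    then have "z \<in> D (restrict k (S y))" using z cardy by (auto simp: D_def piece_def)
    moreover have "restrict k (S y) \<in> S y \<rightarrow>\<^sub>E {..<m}" using k by auto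
    ultimately show "z \<in> \<Union>\<D>" unfolding \<D>_def by blast
  qed
  have "cb_derivative Y (piece (\<Union>i<m. F i) n) (card \<D>) \<inter> meeting (S y) U = {}"
    by (rule cb_derivative_card_cover[OF t1 fin disc N(1) cover])
  then show ?thesis using N(2) by blast
qed

lemma topspace_eq_UN_piece:
  fixes F :: "nat \<Rightarrow> 'a set"
  assumes "topspace X = (\<Union>i. F i)"
  shows "topspace Y = (\<Union>(n, m). piece (\<Union>i<m. F i) n)"
proof -
  have "\<exists>m. S y \<subseteq> (\<Union>i<m. F i)" if y: "y \<in> topspace Y" for y
  proof -
    have "\<forall>x\<in>S y. \<exists>i. x \<in> F i" using S_subset[OF y] assms by auto
    then obtain k where k: "\<And>x. x \<in> S y \<Longrightarrow> x \<in> F (k x)" by metis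
    have "finite (k ` S y)" using finite_S[OF y] by simp
    then obtain m where "\<forall>i\<in>k ` S y. i < m"
      using finite_nat_set_iff_bounded by metis
    then have "S y \<subseteq> (\<Union>i<m. F i)" using k by auto
    then show ?thesis by blast
  qed
  then show ?thesis by (auto simp: piece_def)
qed

theorem sigma_scattered_domain:
  assumes "sigma_scattered X"
  shows "sigma_scattered Y"
proof -
  obtain F :: "nat \<Rightarrow> 'a set" where F: "topspace X = (\<Union>i. F i)"
      "\<And>i. scattered_space (subtopology X (F i))"
    using assms unfolding sigma_scattered_def by blast
  show ?thesis
  proof (rule sigma_scattered_countable_cover[OF topspace_eq_UN_piece[OF F(1)]])
    fix i :: "nat \<times> nat"
    show "scattered_space (subtopology Y (case i of (n, m) \<Rightarrow> piece (\<Union>i<m. F i) n))"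
      using scattered_piece[OF scattered_UN_lessThan[OF Hausdorff_imp_t1_space[OF Hausdorff] F(2)]]
      by (auto split: prod.split)
  qed
qed

theorem sigma_discrete_domain:
  assumes "sigma_discrete X"
  shows "sigma_discrete Y"
proof -
  obtain F :: "nat \<Rightarrow> 'a set" where F: "topspace X = (\<Union>i. F i)"
      "\<And>i. subtopology X (F i) = discrete_topology (F i)"
    using assms unfolding sigma_discrete_def by blast
  have discrete: "F i \<inter> X derived_set_of (F i) = {}" for i
    using F(2)[of i] by (simp only: subtopology_eq_discrete_topology_eq)
  define A where "A n m = piece (\<Union>i<m. F i) n" for n m
  define D where "D = (\<lambda>(n, m, k). cb_derivative Y (A n m) k - cb_derivative Y (A n m) (Suc k))"
  have AY: "A n m \<subseteq> topspace Y" for n m by (auto simp: A_def piece_def)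
  show ?thesis
  proof (rule sigma_discrete_countable_cover[of _ D])
    show "topspace Y = (\<Union>i. D i)"
    proof
      show "(\<Union>i. D i) \<subseteq> topspace Y"
      proof
        fix y assume "y \<in> (\<Union>i. D i)"
        then obtain n m k where "y \<in> cb_derivative Y (A n m) k" by (auto simp: D_def)
        then show "y \<in> topspace Y" using cb_derivative_subset AY by fast
      qed
      show "topspace Y \<subseteq> (\<Union>i. D i)"
      proof
        fix y assume "y \<in> topspace Y"
        then obtain n m where y: "y \<in> A n m"
          using topspace_eq_UN_piece[OF F(1)] by (auto simp: A_def)
        then obtain k where "y \<notin> cb_derivative Y (A n m) k"
          using piece_finite_cb_rank[of F y m n] discrete unfolding A_def by metis
        then have "\<exists>k. y \<in> D (n, m, k)"
        proof (rule contrapos_np)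
          assume never: "\<nexists>k. y \<in> D (n, m, k)"
          show "y \<in> cb_derivative Y (A n m) k"
          proof (induction k)
            case (Suc k)
            then show ?case using never by (auto simp: D_def)
          qed (use y in simp)
        qed
        then show "y \<in> (\<Union>i. D i)" by blast
      qed
    qed
    show "subtopology Y (D i) = discrete_topology (D i)" for i
      using cb_level_discrete[OF AY] by (auto simp: D_def split: prod.split)
  qed
qed

end

section \<open>Supports of the functionals dual to a linear surjection\<close>

text \<open>
  Gaussian elimination: a homogeneous system with fewer equations (indexed by \<open>F\<close>) than unknowns
  (indexed by \<open>Z\<close>) has a nontrivial solution.
\<close>
lemma homogeneous_system_nontrivial:
  fixes b :: "'b \<Rightarrow> 'a \<Rightarrow> real"
  assumes "finite F" "finite Z" "card F < card Z"
  shows "\<exists>c. (\<exists>y\<in>Z. c y \<noteq> 0) \<and> (\<forall>x\<in>F. (\<Sum>y\<in>Z. c y * b y x) = 0)"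
  using assms
proof (induction F arbitrary: Z b rule: finite_induct)
  case empty
  then show ?case by (intro exI[of _ "\<lambda>_. 1"]) (auto simp: card_gt_0_iff)
next
  case (insert x F)
  show ?case
  proof (cases "\<forall>y\<in>Z. b y x = 0")
    case True
    have less: "card F < card Z" using insert.hyps insert.prems by simp
    obtain c where c: "\<exists>y\<in>Z. c y \<noteq> 0" "\<forall>t\<in>F. (\<Sum>y\<in>Z. c y * b y t) = 0"
      using insert.IH[OF insert.prems(1) less, of b] by (elim exE conjE)
    have "(\<Sum>y\<in>Z. c y * b y x) = 0" using True by simp
    then show ?thesis using c by (intro exI[of _ c]) simp
  next
    case False
    then obtain y0 where y0: "y0 \<in> Z" "b y0 x \<noteq> 0" by blast
    let ?Z = "Z - {y0}"
    \<comment> \<open>Eliminate the unknown \<open>y0\<close> with the equation \<open>x\<close>.\<close>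
    define b' where "b' y t = b y t - b y x / b y0 x * b y0 t" for y t
    have less: "card F < card ?Z" using insert.hyps insert.prems y0 by simp
    obtain c where c: "\<exists>y\<in>?Z. c y \<noteq> 0" "\<forall>t\<in>F. (\<Sum>y\<in>?Z. c y * b' y t) = 0"
      using insert.IH[OF finite_Diff[OF insert.prems(1)] less, of b'] by (elim exE conjE)
    define d where "d = c(y0 := - (\<Sum>y\<in>?Z. c y * (b y x / b y0 x)))"
    have sum_d: "(\<Sum>y\<in>Z. d y * b y t) = (\<Sum>y\<in>?Z. c y * b' y t)" for t
    proof -
      have "(\<Sum>y\<in>Z. d y * b y t) = d y0 * b y0 t + (\<Sum>y\<in>?Z. d y * b y t)"
        using y0 insert.prems by (simp add: sum.remove)
      also have "(\<Sum>y\<in>?Z. d y * b y t) = (\<Sum>y\<in>?Z. c y * b y t)"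
        by (intro sum.cong) (auto simp: d_def)
      also have "d y0 * b y0 t = - (\<Sum>y\<in>?Z. c y * (b y x / b y0 x * b y0 t))"
        by (simp add: d_def sum_distrib_right mult.assoc)
      finally show ?thesis
        by (simp add: b'_def right_diff_distrib sum_subtractf)
    qed
    have "(\<Sum>y\<in>Z. d y * b y t) = 0" if "t \<in> insert x F" for t
    proof (cases "t = x")
      case True
      then have "b' y t = 0" for y using y0 by (simp add: b'_def)
      then show ?thesis by (simp add: sum_d)
    next
      case False
      then show ?thesis using that c by (simp add: sum_d)
    qed
    moreover have "\<exists>y\<in>Z. d y \<noteq> 0" using c(1) by (auto simp: d_def)
    ultimately show ?thesis by blast
  qed
qed

lemma restrict_in_Cp:
  assumes "continuous_map X euclideanreal f"
  shows "restrict f (topspace X) \<in> topspace (Cp X)"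
proof -
  have "continuous_map X euclideanreal (restrict f (topspace X))"
    using assms by (rule continuous_map_eq) simp
  then show ?thesis by (simp add: topspace_Cp)
qed

lemma Cp_separating_function:
  assumes "tychonoff_space X" "closedin X C" "x \<in> topspace X" "x \<notin> C"
  obtains g where "g \<in> topspace (Cp X)" "g x = 1" "\<And>z. z \<in> C \<Longrightarrow> g z = 0"
proof -
  have "\<exists>f. continuous_map X euclideanreal f \<and> f x = 1 \<and> f ` C \<subseteq> {0}"
    using assms completely_regular_space_gen_alt[of "1::real" 0 X]
    by (simp add: tychonoff_space_def)
  then obtain f where f: "continuous_map X euclideanreal f" "f x = 1" "f ` C \<subseteq> {0}"
    by blast
  have "C \<subseteq> topspace X" using assms(2) closedin_subset by blast
  then show thesis
    using that[of "restrict f (topspace X)"] f restrict_in_Cp[OF f(1)] \<open>C \<subseteq> topspace X\<close> assms(3) by force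
qed

lemma Cp_separating_finite:
  assumes "tychonoff_space X" "finite G" "G \<subseteq> topspace X" "x \<in> G"
  obtains g where "g \<in> topspace (Cp X)" "g x = 1" "\<And>z. z \<in> G - {x} \<Longrightarrow> g z = 0"
proof -
  have "closedin X (G - {x})"
    using assms by (intro closedin_Hausdorff_finite) (auto simp: tychonoff_space_def)
  then show thesis using Cp_separating_function[OF assms(1), of "G - {x}" x] assms that by auto
qed

lemma Cp_linear_add_at:
  assumes "Cp_linear X Y T" "f \<in> topspace (Cp X)" "g \<in> topspace (Cp X)" "y \<in> topspace Y"
  shows "T (\<lambda>x\<in>topspace X. f x + g x) y = T f y + T g y"
  using assms by (simp add: Cp_linear_def)

lemma Cp_linear_scale_at:
  assumes "Cp_linear X Y T" "f \<in> topspace (Cp X)" "y \<in> topspace Y"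
  shows "T (\<lambda>x\<in>topspace X. c * f x) y = c * T f y"
  using assms by (simp add: Cp_linear_def)

lemma Cp_linear_combination:
  assumes lin: "Cp_linear X Y T" and "finite F" and "\<And>x. x \<in> F \<Longrightarrow> g x \<in> topspace (Cp X)"
    and y: "y \<in> topspace Y"
  shows "(\<lambda>z\<in>topspace X. \<Sum>x\<in>F. c x * g x z) \<in> topspace (Cp X) \<and>
         T (\<lambda>z\<in>topspace X. \<Sum>x\<in>F. c x * g x z) y = (\<Sum>x\<in>F. c x * T (g x) y)"
  using assms(2,3)
proof (induction F rule: finite_induct)
  case empty
  have zero: "(\<lambda>z\<in>topspace X. 0) \<in> topspace (Cp X)"
    by (rule restrict_in_Cp) simp
  have "(\<lambda>z\<in>topspace X. 0 * (\<lambda>z\<in>topspace X. 0::real) z) = (\<lambda>z\<in>topspace X. 0)"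
    by (rule ext) simp
  then have "T (\<lambda>z\<in>topspace X. 0) y = 0"
    using Cp_linear_scale_at[OF lin zero y, of 0] by simp
  then show ?case using zero by (simp add: restrict_def)
next
  case (insert x F)
  let ?h = "\<lambda>z\<in>topspace X. \<Sum>x\<in>F. c x * g x z" and ?k = "\<lambda>z\<in>topspace X. c x * g x z"
  have "?h \<in> topspace (Cp X) \<and> T ?h y = (\<Sum>x\<in>F. c x * T (g x) y)"
    by (rule insert.IH) (rule insert.prems, rule insertI2)
  then have h: "?h \<in> topspace (Cp X)" "T ?h y = (\<Sum>x\<in>F. c x * T (g x) y)"
    by (rule conjunct1, rule conjunct2)
  have gx: "g x \<in> topspace (Cp X)" by (rule insert.prems) simp
  have k: "?k \<in> topspace (Cp X)"
    using gx by (intro restrict_in_Cp continuous_map_real_mult) (auto simp: topspace_Cp)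
  have Tk: "T ?k y = c x * T (g x) y" by (rule Cp_linear_scale_at[OF lin gx y])
  have eq: "(\<lambda>z\<in>topspace X. \<Sum>x\<in>insert x F. c x * g x z) = (\<lambda>z\<in>topspace X. ?k z + ?h z)"
    using insert(1,2) by (intro ext) simp
  have kh: "(\<lambda>z\<in>topspace X. ?k z + ?h z) \<in> topspace (Cp X)"
    using h(1) k by (intro restrict_in_Cp continuous_map_add) (simp_all only: topspace_Cp mem_Collect_eq)
  have "T (\<lambda>z\<in>topspace X. ?k z + ?h z) y = (\<Sum>x\<in>insert x F. c x * T (g x) y)"
    unfolding Cp_linear_add_at[OF lin k h(1) y] Tk h(2) sum.insert[OF insert(1,2)] ..
  with kh show ?case unfolding eq by (rule conjI)
qed

text \<open>
  Continuity at zero bounds the functional by 1 on all functions that vanish on some finite set.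
  These functions form a linear subspace, and a linear functional bounded on a subspace is zero
  there.
\<close>
lemma functional_finitely_determined:
  assumes cont: "continuous_map (Cp X) (Cp Y) T" and lin: "Cp_linear X Y T"
    and y: "y \<in> topspace Y"
  obtains F where "finite F" "F \<subseteq> topspace X"
    "\<And>f. f \<in> topspace (Cp X) \<Longrightarrow> (\<And>x. x \<in> F \<Longrightarrow> f x = 0) \<Longrightarrow> T f y = 0"
proof -
  let ?P = "product_topology (\<lambda>x. euclideanreal) (topspace X)"
  let ?O = "{f \<in> topspace (Cp X). T f y \<in> {-1<..<1}}"
  let ?z = "\<lambda>x\<in>topspace X. 0 :: real"
  have "continuous_map (Cp Y) euclideanreal (\<lambda>f. f y)"
    unfolding Cp_def using y
    by (intro continuous_map_from_subtopology continuous_map_product_projection)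
  then have "continuous_map (Cp X) euclideanreal (\<lambda>f. T f y)"
    using continuous_map_compose[OF cont] by (simp add: o_def)
  then have "openin (Cp X) ?O"
    by (rule openin_continuous_map_preimage) auto
  then obtain O' where O': "openin ?P O'" "?O = O' \<inter> {f. continuous_map X euclideanreal f}"
    by (auto simp: Cp_def openin_subtopology)
  have z: "?z \<in> topspace (Cp X)" "T ?z y = 0"
    using Cp_linear_combination[OF lin, of "{}" _ y] y by auto
  have "?z \<in> ?O" using z by simp
  then have "?z \<in> O'" using O'(2) by blast
  with O'(1) have "\<exists>U. finite {i \<in> topspace X. U i \<noteq> topspace euclideanreal} \<and>
      (\<forall>i\<in>topspace X. openin euclideanreal (U i)) \<and>
      ?z \<in> Pi\<^sub>E (topspace X) U \<and> Pi\<^sub>E (topspace X) U \<subseteq> O'"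
    unfolding openin_product_topology_alt by (rule bspec)
  then obtain U where U: "finite {i \<in> topspace X. U i \<noteq> UNIV}" "?z \<in> Pi\<^sub>E (topspace X) U"
      "Pi\<^sub>E (topspace X) U \<subseteq> O'"
    unfolding topspace_euclidean by (elim exE conjE)
  define F where "F = {i \<in> topspace X. U i \<noteq> UNIV}"
  have bound: "\<bar>T f y\<bar> < 1" if f: "f \<in> topspace (Cp X)" "\<And>x. x \<in> F \<Longrightarrow> f x = 0" for f
  proof -
    have "f i \<in> U i" if i: "i \<in> topspace X" for i
    proof (cases "i \<in> F")
      case True
      then show ?thesis using f(2)[OF True] PiE_mem[OF U(2) i] i by simp
    qed (use i in \<open>auto simp: F_def\<close>)
    then have "f \<in> Pi\<^sub>E (topspace X) U" using f(1) by (auto simp: topspace_Cp PiE_def)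
    then have "f \<in> ?O" using U(3) O'(2) f(1) by (auto simp: topspace_Cp)
    then show ?thesis by auto
  qed
  show thesis
  proof
    show "finite F" "F \<subseteq> topspace X" using U by (auto simp: F_def)
    fix f assume f: "f \<in> topspace (Cp X)" "\<And>x. x \<in> F \<Longrightarrow> f x = 0"
    show "T f y = 0"
    proof (rule ccontr)
      assume nz: "T f y \<noteq> 0"
      \<comment> \<open>A multiple of \<open>f\<close>, written as a sum with one summand, with value 1 under the functional.\<close>
      let ?g = "\<lambda>z\<in>topspace X. \<Sum>x\<in>{()}. (1 / T f y) * f z"
      have g: "?g \<in> topspace (Cp X)" "T ?g y = (\<Sum>x\<in>{()}. (1 / T f y) * T f y)"
        using Cp_linear_combination[OF lin, of "{()}" "\<lambda>_. f" y "\<lambda>_. 1 / T f y"] f(1) y by auto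
      have "?g x = 0" if "x \<in> F" for x using that f(2) by (auto simp: F_def)
      then have "\<bar>T ?g y\<bar> < 1" using bound g(1) by blast
      then show False using g(2) nz by simp
    qed
  qed
qed

text \<open>
  With functions \<open>g x\<close> dual to the points of the determining set \<open>F\<close>, every \<open>f\<close> agrees on \<open>F\<close>
  with the combination of the \<open>g x\<close> with coefficients \<open>f x\<close>, so both have the same image under the
  functional.
\<close>
lemma functional_finite_support:
  assumes X: "tychonoff_space X"
    and cont: "continuous_map (Cp X) (Cp Y) T" and lin: "Cp_linear X Y T"
    and y: "y \<in> topspace Y"
  shows "\<exists>S a. finite S \<and> S \<subseteq> topspace X \<and> (\<forall>x\<in>S. a x \<noteq> 0) \<and>
    (\<forall>f\<in>topspace (Cp X). T f y = (\<Sum>x\<in>S. a x * f x))"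
proof -
  obtain F where F: "finite F" "F \<subseteq> topspace X"
    "\<And>f. f \<in> topspace (Cp X) \<Longrightarrow> (\<And>x. x \<in> F \<Longrightarrow> f x = 0) \<Longrightarrow> T f y = 0"
    using functional_finitely_determined[OF cont lin y] by blast
  have "\<forall>x\<in>F. \<exists>g. g \<in> topspace (Cp X) \<and> g x = 1 \<and> (\<forall>z\<in>F - {x}. g z = 0)"
    using Cp_separating_finite[OF X F(1,2)] by metis
  then obtain g where g: "\<And>x. x \<in> F \<Longrightarrow> g x \<in> topspace (Cp X)" "\<And>x. x \<in> F \<Longrightarrow> g x x = 1"
      "\<And>x z. x \<in> F \<Longrightarrow> z \<in> F \<Longrightarrow> z \<noteq> x \<Longrightarrow> g x z = 0"
    by (metis DiffI singletonD)
  have expand: "T f y = (\<Sum>x\<in>F. T (g x) y * f x)" if f: "f \<in> topspace (Cp X)" for f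
  proof -
    let ?h = "\<lambda>z\<in>topspace X. \<Sum>x\<in>F. f x * g x z"
    have h: "?h \<in> topspace (Cp X)" "T ?h y = (\<Sum>x\<in>F. f x * T (g x) y)"
      using Cp_linear_combination[OF lin F(1), of g y f] g(1) y by auto
    \<comment> \<open>The difference \<open>f - ?h\<close>, as a linear combination indexed by the two truth values.\<close>
    let ?k = "\<lambda>b. if b then f else ?h" and ?c = "\<lambda>b. if b then 1 else - 1 :: real"
    let ?d = "\<lambda>z\<in>topspace X. \<Sum>b\<in>(UNIV::bool set). ?c b * ?k b z"
    have d: "?d \<in> topspace (Cp X)" "T ?d y = (\<Sum>b\<in>UNIV. ?c b * T (?k b) y)"
      using Cp_linear_combination[OF lin, of "UNIV" ?k y ?c] f h(1) y by auto
    have "?d z = 0" if z: "z \<in> F" for z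
    proof -
      have "(\<Sum>x\<in>F. f x * g x z) = (\<Sum>x\<in>F. if x = z then f z else 0)"
        using g z by (intro sum.cong) auto
      then have "?h z = f z" using z F by auto
      moreover have "?d z = f z - ?h z" using z F(2) by (auto simp: UNIV_bool)
      ultimately show ?thesis by simp
    qed
    then have "T ?d y = 0" using F(3) d(1) by blast
    then have "T f y = T ?h y" using d(2) by (simp add: UNIV_bool)
    then show ?thesis using h(2) by (simp add: mult.commute)
  qed
  let ?S = "{x \<in> F. T (g x) y \<noteq> 0}"
  have "T f y = (\<Sum>x\<in>?S. T (g x) y * f x)" if "f \<in> topspace (Cp X)" for f
    unfolding expand[OF that] using F(1) by (intro sum.mono_neutral_right) auto
  then show ?thesis
    using F by (intro exI[of _ ?S] exI[of _ "\<lambda>x. T (g x) y"]) auto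
qed

text \<open>
  More than \<open>card G\<close> functionals supported in \<open>G\<close> are linearly dependent.  By surjectivity the
  dependence would hold for the evaluations of all continuous functions on \<open>Y\<close>, but these separate
  a point from any finite set of other points.
\<close>
lemma finite_supports_within:
  assumes Y: "tychonoff_space Y" and surj: "T ` topspace (Cp X) = topspace (Cp Y)"
    and S: "\<And>y. y \<in> topspace Y \<Longrightarrow> finite (S y)"
    and rep: "\<And>y f. y \<in> topspace Y \<Longrightarrow> f \<in> topspace (Cp X) \<Longrightarrow>
      T f y = (\<Sum>x\<in>S y. a y x * f x)"
    and G: "finite G"
  shows "finite {y \<in> topspace Y. S y \<subseteq> G}"
proof -
  have "card Z \<le> card G" if Z: "Z \<subseteq> {y \<in> topspace Y. S y \<subseteq> G}" "finite Z" for Z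
  proof (rule ccontr)
    assume "\<not> card Z \<le> card G"
    define b where "b y x = (if x \<in> S y then a y x else 0)" for y x
    obtain c y1 where c: "y1 \<in> Z" "c y1 \<noteq> 0" "\<And>x. x \<in> G \<Longrightarrow> (\<Sum>y\<in>Z. c y * b y x) = 0"
      using homogeneous_system_nontrivial[OF G Z(2), of b] \<open>\<not> card Z \<le> card G\<close> by auto
    obtain g where g: "g \<in> topspace (Cp Y)" "g y1 = 1" "\<And>z. z \<in> Z - {y1} \<Longrightarrow> g z = 0"
      using Cp_separating_finite[OF Y Z(2) _ c(1)] Z(1) by auto
    obtain f where f: "f \<in> topspace (Cp X)" "T f = g" using g(1) surj by (metis imageE)
    have gb: "g y = (\<Sum>x\<in>G. b y x * f x)" if "y \<in> Z" for y
    proof -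
      have "g y = (\<Sum>x\<in>S y. a y x * f x)" using rep f that Z by auto
      also have "\<dots> = (\<Sum>x\<in>S y. b y x * f x)" by (intro sum.cong) (auto simp: b_def)
      also have "\<dots> = (\<Sum>x\<in>G. b y x * f x)"
        using that Z G by (intro sum.mono_neutral_left) (auto simp: b_def)
      finally show ?thesis .
    qed
    have "(\<Sum>y\<in>Z. c y * g y) = (\<Sum>y\<in>Z. \<Sum>x\<in>G. c y * b y x * f x)"
      by (intro sum.cong) (auto simp: gb sum_distrib_left mult.assoc)
    also have "\<dots> = (\<Sum>x\<in>G. (\<Sum>y\<in>Z. c y * b y x) * f x)"
      by (subst sum.swap) (simp add: sum_distrib_right)
    also have "\<dots> = 0" using c(3) by simp
    finally have "(\<Sum>y\<in>Z. c y * g y) = 0" .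
    moreover have "(\<Sum>y\<in>Z. c y * g y) = c y1"
      using c(1) g Z(2) by (simp add: sum.remove)
    ultimately show False using c(2) by simp
  qed
  then show ?thesis by (rule finite_if_finite_subsets_card_bdd[THEN conjunct1])
qed

text \<open>
  Take \<open>g\<close> with \<open>g x = 1\<close> that vanishes outside \<open>U\<close> and at the other points of \<open>S y\<close>.  Then
  \<open>T g y\<close> is the nonzero coefficient at \<open>x\<close>, and wherever \<open>T g\<close> is nonzero the support must meet \<open>U\<close>.
\<close>
lemma support_lsc:
  assumes X: "tychonoff_space X" and cont: "continuous_map (Cp X) (Cp Y) T"
    and S: "\<And>y. y \<in> topspace Y \<Longrightarrow> finite (S y) \<and> S y \<subseteq> topspace X \<and> (\<forall>x\<in>S y. a y x \<noteq> 0)"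
    and rep: "\<And>y f. y \<in> topspace Y \<Longrightarrow> f \<in> topspace (Cp X) \<Longrightarrow>
      T f y = (\<Sum>x\<in>S y. a y x * f x)"
    and U: "openin X U"
  shows "openin Y {y \<in> topspace Y. S y \<inter> U \<noteq> {}}"
proof (subst openin_subopen, intro ballI)
  fix y assume "y \<in> {y \<in> topspace Y. S y \<inter> U \<noteq> {}}"
  then obtain x where y: "y \<in> topspace Y" and x: "x \<in> S y" "x \<in> U" by blast
  have xX: "x \<in> topspace X" and Sy: "finite (S y)" "S y \<subseteq> topspace X" "a y x \<noteq> 0"
    using S[OF y] x by auto
  let ?C = "(topspace X - U) \<union> (S y - {x})"
  have "closedin X (S y - {x})"
    using X Sy by (intro closedin_Hausdorff_finite) (auto simp: tychonoff_space_def)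
  then have "closedin X ?C" using U by (intro closedin_Un) auto
  then obtain g where g: "g \<in> topspace (Cp X)" "g x = 1" "\<And>z. z \<in> ?C \<Longrightarrow> g z = 0"
    using Cp_separating_function[OF X _ xX] x by blast
  have "T g \<in> topspace (Cp Y)" using cont g(1) by (auto simp: continuous_map_def)
  then have "continuous_map Y euclideanreal (T g)" by (simp add: topspace_Cp)
  then have "openin Y {y \<in> topspace Y. T g y \<in> - {0}}"
    by (rule openin_continuous_map_preimage) auto
  moreover have "T g y \<noteq> 0"
  proof -
    have "T g y = (\<Sum>z\<in>S y. a y z * g z)" using rep y g(1) by auto
    also have "\<dots> = a y x" using g x Sy by (simp add: sum.remove)
    finally show ?thesis using Sy by simp
  qed
  moreover have "S w \<inter> U \<noteq> {}" if w: "w \<in> topspace Y" "T g w \<noteq> 0" for w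
  proof
    assume "S w \<inter> U = {}"
    then have "g z = 0" if "z \<in> S w" for z using that S[OF w(1)] g(3) by blast
    then show False using w rep[OF w(1) g(1)] by simp
  qed
  ultimately show "\<exists>T. openin Y T \<and> y \<in> T \<and> T \<subseteq> {y \<in> topspace Y. S y \<inter> U \<noteq> {}}"
    using y by (intro exI[of _ "{y \<in> topspace Y. T g y \<in> - {0}}"]) auto
qed

theorem l_dominated_finite_lsc_map:
  assumes X: "tychonoff_space X" and Y: "tychonoff_space Y" and dom: "l_dominated_by Y X"
  shows "\<exists>S. finite_lsc_map X Y S"
proof -
  obtain T where T: "continuous_map (Cp X) (Cp Y) T" "Cp_linear X Y T"
      "T ` topspace (Cp X) = topspace (Cp Y)"
    using dom unfolding l_dominated_by_def by blast
  have "\<forall>y\<in>topspace Y. \<exists>S a. finite S \<and> S \<subseteq> topspace X \<and> (\<forall>x\<in>S. a x \<noteq> 0) \<and>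
      (\<forall>f\<in>topspace (Cp X). T f y = (\<Sum>x\<in>S. a x * f x))"
    using functional_finite_support[OF X T(1,2)] by blast
  then obtain S a where S: "\<And>y. y \<in> topspace Y \<Longrightarrow>
      finite (S y) \<and> S y \<subseteq> topspace X \<and> (\<forall>x\<in>S y. a y x \<noteq> 0)"
    and rep: "\<And>y f. y \<in> topspace Y \<Longrightarrow> f \<in> topspace (Cp X) \<Longrightarrow>
      T f y = (\<Sum>x\<in>S y. a y x * f x)"
    by metis
  have "finite_lsc_map X Y S"
  proof
    show "Hausdorff_space X" "t1_space Y"
      using X Y by (auto simp: tychonoff_space_def Hausdorff_imp_t1_space)
    show "finite (S y)" "S y \<subseteq> topspace X" if "y \<in> topspace Y" for y
      using S[OF that] by auto
    show "openin Y {y \<in> topspace Y. S y \<inter> U \<noteq> {}}" if "openin X U" for U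
      using support_lsc[OF X T(1) S rep that] by blast
    show "finite {y \<in> topspace Y. S y = G}" for G
    proof (cases "finite G")
      case True
      have "finite {y \<in> topspace Y. S y \<subseteq> G}"
        using finite_supports_within[OF Y T(3) _ rep True] S by blast
      then show ?thesis by (rule rev_finite_subset) auto
    next
      case False
      then have "{y \<in> topspace Y. S y = G} = {}" using S by blast
      then show ?thesis by (simp only: finite.emptyI)
    qed
  qed
  then show ?thesis by blast
qed

theorem proposition3p7:
  fixes X :: "'a topology" and Y :: "'b topology"
  assumes "tychonoff_space X" and "tychonoff_space Y"
    and "l_dominated_by Y X"
  shows "(sigma_scattered X \<longrightarrow> sigma_scattered Y) \<and>
         (sigma_discrete X \<longrightarrow> sigma_discrete Y)"
proof -
  obtain S where "finite_lsc_map X Y S"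
    using l_dominated_finite_lsc_map[OF assms] by blast
  then show ?thesis
    using finite_lsc_map.sigma_scattered_domain finite_lsc_map.sigma_discrete_domain by blast
qed

end
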